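(* Let $R$ be a semisimple ring, and (by the Wedderburn–Artin theorem) identify $R$ with a direct product $\prod_{i=1}^k R_i$, where $R_i := \mathcal{M}_{n_i}(D_i)$, $k \ge 1$, $1 \le n_1 \le \cdots \le n_k$ are integers, and $D_1, \ldots, D_k$ are skew fields. Then the multiplicative submonoid $\mathcal{E}(R)$ of $R$ generated by the idempotents of $R$ is $$\mathcal{E}(R) = \prod_{i=1}^k R_i^\#.$$ Moreover, for every $x = (x_1, \ldots, x_k) \in \prod_{i=1}^k R_i^\#$, the minimum length $\ell(x)$ of an idempotent factorization of $x$ in $R$ satisfies $\ell(x) \le \max_{1 \le i \le k} \ell_i(x)$, where $\ell_i(x)$ is the minimum length of an idempotent factorization of $x_i$ in $R_i^\#$; in particular, $\ell(x) \le \max(n_1, \ldots, n_k) = n_k$.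
   Context: A ring (associative, non-zero, with identity) is semisimple if every right ideal is a direct summand of the right regular module. $\mathcal{M}_n(D)$ is the ring of $n$-by-$n$ matrices over $D$. For a ring $S$, $S^\#$ denotes the multiplicative submonoid of $S$ consisting of the identity $1_S$ and of all elements that are both left and right zero divisors of $S$. An idempotent factorization of an element is an expression of it as a finite product of idempotents (the empty product being the identity); its length is the number of factors. *)

theory Defs
  imports "HOL-Algebra.Algebra" "HOL-Library.Extended_Nat"
begin

definition skew_field :: "('a, 'm) ring_scheme \<Rightarrow> bool"
  where "skew_field D \<longleftrightarrow> ring D \<and> \<one>\<^bsub>D\<^esub> \<noteq> \<zero>\<^bsub>D\<^esub> \<and> Units D = carrier D - {\<zero>\<^bsub>D\<^esub>}"

definition right_ideal :: "'a set \<Rightarrow> ('a, 'm) ring_scheme \<Rightarrow> bool"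
  where "right_ideal I R \<longleftrightarrow>
    additive_subgroup I R \<and> (\<forall>a\<in>I. \<forall>r\<in>carrier R. a \<otimes>\<^bsub>R\<^esub> r \<in> I)"

text \<open>Right ideals are exactly the submodules of the right regular module, so a complement of
  \<open>I\<close> in that module is again a right ideal.\<close>

definition semisimple_ring :: "('a, 'm) ring_scheme \<Rightarrow> bool"
  where "semisimple_ring R \<longleftrightarrow> ring R \<and> \<one>\<^bsub>R\<^esub> \<noteq> \<zero>\<^bsub>R\<^esub> \<and>
    (\<forall>I. right_ideal I R \<longrightarrow>
      (\<exists>J. right_ideal J R \<and> I \<inter> J = {\<zero>\<^bsub>R\<^esub>} \<and> I <+>\<^bsub>R\<^esub> J = carrier R))"

text \<open>Matrices are functions on index pairs, extensional outside \<open>{1..n} \<times> {1..n}\<close> so that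
  equality of carrier elements is equality of entries.\<close>

definition mat_ring :: "nat \<Rightarrow> ('a, 'm) ring_scheme \<Rightarrow> (nat \<times> nat \<Rightarrow> 'a) ring"
  where "mat_ring n D =
    \<lparr> carrier = {1..n} \<times> {1..n} \<rightarrow>\<^sub>E carrier D,
      monoid.mult = (\<lambda>A B. \<lambda>(i, j) \<in> {1..n} \<times> {1..n}. \<Oplus>\<^bsub>D\<^esub>l\<in>{1..n}. A (i, l) \<otimes>\<^bsub>D\<^esub> B (l, j)),
      one = (\<lambda>(i, j) \<in> {1..n} \<times> {1..n}. if i = j then \<one>\<^bsub>D\<^esub> else \<zero>\<^bsub>D\<^esub>),
      ring.zero = (\<lambda>(i, j) \<in> {1..n} \<times> {1..n}. \<zero>\<^bsub>D\<^esub>),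
      ring.add = (\<lambda>A B. \<lambda>(i, j) \<in> {1..n} \<times> {1..n}. A (i, j) \<oplus>\<^bsub>D\<^esub> B (i, j)) \<rparr>"

text \<open>The ring analogue of \<^const>\<open>product_group\<close>.\<close>

definition product_ring :: "'i set \<Rightarrow> ('i \<Rightarrow> ('a, 'm) ring_scheme) \<Rightarrow> ('i \<Rightarrow> 'a) ring"
  where "product_ring I R =
    \<lparr> carrier = (\<Pi>\<^sub>E i\<in>I. carrier (R i)),
      monoid.mult = (\<lambda>x y. \<lambda>i\<in>I. x i \<otimes>\<^bsub>R i\<^esub> y i),
      one = (\<lambda>i\<in>I. \<one>\<^bsub>R i\<^esub>),
      ring.zero = (\<lambda>i\<in>I. \<zero>\<^bsub>R i\<^esub>),
      ring.add = (\<lambda>x y. \<lambda>i\<in>I. x i \<oplus>\<^bsub>R i\<^esub> y i) \<rparr>"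

text \<open>In a non-zero ring, zero itself counts as a zero divisor on both sides.\<close>

definition left_zero_divisor :: "('a, 'm) ring_scheme \<Rightarrow> 'a \<Rightarrow> bool"
  where "left_zero_divisor S a \<longleftrightarrow>
    a \<in> carrier S \<and> (\<exists>b\<in>carrier S. b \<noteq> \<zero>\<^bsub>S\<^esub> \<and> a \<otimes>\<^bsub>S\<^esub> b = \<zero>\<^bsub>S\<^esub>)"

definition right_zero_divisor :: "('a, 'm) ring_scheme \<Rightarrow> 'a \<Rightarrow> bool"
  where "right_zero_divisor S a \<longleftrightarrow>
    a \<in> carrier S \<and> (\<exists>b\<in>carrier S. b \<noteq> \<zero>\<^bsub>S\<^esub> \<and> b \<otimes>\<^bsub>S\<^esub> a = \<zero>\<^bsub>S\<^esub>)"

text \<open>The monoid \<open>S\<^sup>#\<close>; only the multiplicative structure of the resulting record is meaningful.\<close>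

definition sharp :: "('a, 'm) ring_scheme \<Rightarrow> ('a, 'm) ring_scheme"
  where "sharp S =
    S\<lparr>carrier := insert \<one>\<^bsub>S\<^esub> {a. left_zero_divisor S a \<and> right_zero_divisor S a}\<rparr>"

lemma submonoid_sharp:
  assumes "ring S"
  shows "submonoid (carrier (sharp S)) S"
proof -
  interpret ring S by fact
  have carr: "carrier (sharp S) =
      insert \<one>\<^bsub>S\<^esub> {a. left_zero_divisor S a \<and> right_zero_divisor S a}"
    by (simp add: sharp_def)
  have sub: "carrier (sharp S) \<subseteq> carrier S"
    unfolding carr left_zero_divisor_def by blast
  have "x \<otimes>\<^bsub>S\<^esub> y \<in> carrier (sharp S)"
    if x: "x \<in> carrier (sharp S)" and y: "y \<in> carrier (sharp S)" for x y
  proof (cases "x = \<one>\<^bsub>S\<^esub> \<or> y = \<one>\<^bsub>S\<^esub>")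
    case True
    with x y sub show ?thesis
      by (metis l_one r_one subsetD)
  next
    case False
    with x y have lr: "right_zero_divisor S x" "left_zero_divisor S y"
      unfolding carr by blast+
    then obtain b c where *: "x \<in> carrier S" "y \<in> carrier S"
      "b \<in> carrier S" "b \<noteq> \<zero>\<^bsub>S\<^esub>" "y \<otimes>\<^bsub>S\<^esub> b = \<zero>\<^bsub>S\<^esub>"
      "c \<in> carrier S" "c \<noteq> \<zero>\<^bsub>S\<^esub>" "c \<otimes>\<^bsub>S\<^esub> x = \<zero>\<^bsub>S\<^esub>"
      unfolding left_zero_divisor_def right_zero_divisor_def by blast
    have "(x \<otimes>\<^bsub>S\<^esub> y) \<otimes>\<^bsub>S\<^esub> b = \<zero>\<^bsub>S\<^esub>"
      using m_assoc[of x y b] * by simp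
    moreover have "c \<otimes>\<^bsub>S\<^esub> (x \<otimes>\<^bsub>S\<^esub> y) = \<zero>\<^bsub>S\<^esub>"
      using m_assoc[of c x y] * by simp
    ultimately have "left_zero_divisor S (x \<otimes>\<^bsub>S\<^esub> y)" "right_zero_divisor S (x \<otimes>\<^bsub>S\<^esub> y)"
      unfolding left_zero_divisor_def right_zero_divisor_def using * m_closed by blast+
    then show ?thesis
      by (simp add: carr)
  qed
  with sub show ?thesis
    by (simp add: submonoid_def carr)
qed

definition idempotents :: "('a, 'm) monoid_scheme \<Rightarrow> 'a set"
  where "idempotents M = {e \<in> carrier M. e \<otimes>\<^bsub>M\<^esub> e = e}"

definition idempotent_generated :: "('a, 'm) monoid_scheme \<Rightarrow> 'a set"
  where "idempotent_generated M = \<Inter>{H. submonoid H M \<and> idempotents M \<subseteq> H}"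

definition idempotent_factorizations :: "('a, 'm) monoid_scheme \<Rightarrow> 'a \<Rightarrow> 'a list set"
  where "idempotent_factorizations M x =
    {es. set es \<subseteq> idempotents M \<and> foldr (\<otimes>\<^bsub>M\<^esub>) es \<one>\<^bsub>M\<^esub> = x}"

text \<open>Infinite if there is no idempotent factorization at all.\<close>

definition idempotent_length :: "('a, 'm) monoid_scheme \<Rightarrow> 'a \<Rightarrow> enat"
  where "idempotent_length M x = (INF es\<in>idempotent_factorizations M x. enat (length es))"

end

theory Submission
  imports Defs
begin

text \<open>Let \<open>A\<close> be a singular matrix over a skew field that is not idempotent. There are vectors
  \<open>v \<noteq> 0\<close> with \<open>A v = 0\<close> and \<open>y\<close> with \<open>(1 - A) A y \<noteq> 0\<close> and, after rescaling both, a linear form \<open>g\<close>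
  with \<open>g v = g (1 - A) A y = 1\<close>. Put \<open>f = g (1 - A)\<close>, \<open>z = y - A y\<close>, \<open>E = 1 - v f\<close> and
  \<open>B = A (1 + z f)\<close>. Then \<open>E\<close> is idempotent, \<open>A = B E\<close>, \<open>B\<close> is singular, and \<open>1 - B\<close> arises from
  \<open>M = 1 - A\<close> by Wedderburn's rank reduction \<open>M - M x g M\<close> with \<open>x = A y\<close> and \<open>g M x = 1\<close>. Hence
  \<open>A\<close> is a product of at most \<open>rank (1 - A) \<le> n\<close> idempotents. In a direct product, factorizations of
  the components are combined after padding with ones. Conversely, an idempotent \<open>e \<noteq> 1\<close> is a
  two-sided zero divisor because of \<open>e (1 - e) = (1 - e) e = 0\<close>.\<close>

section \<open>Idempotent factorizations in monoids\<close>

lemma idempotents_subset_carrier: "idempotents M \<subseteq> carrier M"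
  by (auto simp: idempotents_def)

lemma idempotent_length_le_length:
  "es \<in> idempotent_factorizations M x \<Longrightarrow> idempotent_length M x \<le> enat (length es)"
  unfolding idempotent_length_def by (rule INF_lower)

lemma idempotent_length_attained:
  assumes "idempotent_length M x \<noteq> \<infinity>"
  obtains es where "es \<in> idempotent_factorizations M x" "idempotent_length M x = enat (length es)"
proof -
  let ?L = "(\<lambda>es. enat (length es)) ` idempotent_factorizations M x"
  have "?L \<noteq> {}"
    using assms by (auto simp: idempotent_length_def top_enat_def)
  then have "Inf ?L \<in> ?L"
    by (auto simp: Inf_enat_def intro: LeastI)
  then show thesis
    using that by (auto simp: idempotent_length_def)
qed

context monoid
begin

lemma foldr_mult_append:
  assumes "set xs \<subseteq> carrier G" "set ys \<subseteq> carrier G"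
  shows "foldr (\<otimes>) (xs @ ys) \<one> = foldr (\<otimes>) xs \<one> \<otimes> foldr (\<otimes>) ys \<one>"
  using assms by (induction xs) (auto simp: m_assoc)

lemma idempotent_length_one: "idempotent_length G \<one> = 0"
  using idempotent_length_le_length[of "[]" G \<one>]
  by (simp add: idempotent_factorizations_def flip: zero_enat_def)

lemma idempotent_length_idempotent_le:
  assumes "x \<in> idempotents G"
  shows "idempotent_length G x \<le> 1"
  using assms idempotent_length_le_length[of "[x]" G x]
  by (simp add: idempotent_factorizations_def idempotents_def one_enat_def)

lemma idempotent_length_mult_le:
  "idempotent_length G (x \<otimes> y) \<le> idempotent_length G x + idempotent_length G y"
proof (cases "idempotent_length G x = \<infinity> \<or> idempotent_length G y = \<infinity>")
  case True
  then show ?thesis by auto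
next
  case False
  then obtain xs ys where
    xs: "xs \<in> idempotent_factorizations G x" "idempotent_length G x = enat (length xs)" and
    ys: "ys \<in> idempotent_factorizations G y" "idempotent_length G y = enat (length ys)"
    by (metis idempotent_length_attained)
  have "xs @ ys \<in> idempotent_factorizations G (x \<otimes> y)"
    using xs(1) ys(1) idempotents_subset_carrier[of G]
    by (auto simp: idempotent_factorizations_def foldr_mult_append simp del: foldr_append)
  then show ?thesis
    using xs(2) ys(2) idempotent_length_le_length[of "xs @ ys"] by simp
qed

lemma idempotent_length_imp_carrier:
  assumes "idempotent_length G x \<noteq> \<infinity>"
  shows "x \<in> carrier G"
proof -
  obtain es where "es \<in> idempotent_factorizations G x"
    using assms by (rule idempotent_length_attained)
  then show ?thesis
    using idempotents_subset_carrier[of G] multlist_closed[of es]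
    by (auto simp: idempotent_factorizations_def)
qed

lemma idempotent_generated_eq: "idempotent_generated G = {x. idempotent_length G x \<noteq> \<infinity>}"
  (is "_ = ?F")
proof
  have "submonoid ?F G"
  proof
    show "?F \<subseteq> carrier G"
      using idempotent_length_imp_carrier by auto
    show "x \<otimes> y \<in> ?F" if "x \<in> ?F" "y \<in> ?F" for x y
      using that idempotent_length_mult_le[of x y] by (auto dest: enat_ile)
  qed (simp add: idempotent_length_one zero_enat_def)
  moreover have "x \<in> ?F" if "x \<in> idempotents G" for x
    using idempotent_length_idempotent_le[OF that] by (auto simp: one_enat_def dest: enat_ile)
  ultimately show "idempotent_generated G \<subseteq> ?F"
    unfolding idempotent_generated_def by blast
  show "?F \<subseteq> idempotent_generated G"
  proof
    fix x assume "x \<in> ?F"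
    then have "idempotent_length G x \<noteq> \<infinity>" by simp
    then obtain es where es: "es \<in> idempotent_factorizations G x"
      by (rule idempotent_length_attained)
    have "foldr (\<otimes>) es \<one> \<in> H" if "submonoid H G" "set es \<subseteq> H" for H
      using that(2)
      by (induction es)
        (auto intro: submonoid.m_closed[OF that(1)] submonoid.one_closed[OF that(1)])
    then show "x \<in> idempotent_generated G"
      using es by (auto simp: idempotent_generated_def idempotent_factorizations_def)
  qed
qed

lemma idempotent_generated_subset_carrier: "idempotent_generated G \<subseteq> carrier G"
  using idempotent_length_imp_carrier by (auto simp: idempotent_generated_eq)

lemma idempotent_length_hom_le:
  assumes h: "h \<in> hom G N" "h \<one> = \<one>\<^bsub>N\<^esub>"
  shows "idempotent_length N (h x) \<le> idempotent_length G x"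
proof (cases "idempotent_length G x = \<infinity>")
  case False
  then obtain es where es: "es \<in> idempotent_factorizations G x"
    and len: "idempotent_length G x = enat (length es)"
    by (rule idempotent_length_attained)
  have "set es \<subseteq> carrier G"
    using es idempotents_subset_carrier[of G] by (auto simp: idempotent_factorizations_def)
  then have "foldr (\<otimes>\<^bsub>N\<^esub>) (map h es) \<one>\<^bsub>N\<^esub> = h (foldr (\<otimes>) es \<one>)"
    by (induction es) (simp_all add: h(2) hom_mult[OF h(1)])
  moreover have "h a \<in> idempotents N" if "a \<in> idempotents G" for a
    using that hom_mult[OF h(1), of a a] hom_in_carrier[OF h(1), of a]
    by (simp add: idempotents_def)
  ultimately have "map h es \<in> idempotent_factorizations N (h x)"
    using es by (auto simp: idempotent_factorizations_def)
  then show ?thesis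
    using len idempotent_length_le_length[of "map h es"] by simp
qed simp

end

lemma idempotent_length_ring_iso:
  assumes "ring R" "monoid S" and \<phi>: "\<phi> \<in> ring_iso R S" and x: "x \<in> carrier R"
  shows "idempotent_length S (\<phi> x) = idempotent_length R x"
proof (rule antisym)
  interpret R: ring R by fact
  interpret S: monoid S by fact
  show "idempotent_length S (\<phi> x) \<le> idempotent_length R x"
    using ring_iso_memE(1,2,4)[OF \<phi>] by (simp add: R.idempotent_length_hom_le hom_def Pi_iff)
  let ?\<psi> = "inv_into (carrier R) \<phi>"
  have \<psi>: "?\<psi> \<in> ring_iso S R"
    by (rule ring_iso_set_sym[OF \<open>ring R\<close> \<phi>])
  have "idempotent_length R (?\<psi> (\<phi> x)) \<le> idempotent_length S (\<phi> x)"
    using ring_iso_memE(1,2,4)[OF \<psi>] by (simp add: S.idempotent_length_hom_le hom_def Pi_iff)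
  moreover have "?\<psi> (\<phi> x) = x"
    using ring_iso_memE(5)[OF \<phi>] x by (simp add: bij_betw_def)
  ultimately show "idempotent_length R x \<le> idempotent_length S (\<phi> x)" by simp
qed

lemma idempotent_generated_ring_iso:
  assumes R: "ring R" and S: "monoid S" and \<phi>: "\<phi> \<in> ring_iso R S"
  shows "\<phi> ` idempotent_generated R = idempotent_generated S"
proof -
  interpret R: ring R by (rule R)
  interpret S: monoid S by (rule S)
  have "{x \<in> carrier R. \<phi> x \<in> idempotent_generated S} = idempotent_generated R"
    using idempotent_length_ring_iso[OF R S \<phi>] R.idempotent_length_imp_carrier
    by (auto simp: R.idempotent_generated_eq S.idempotent_generated_eq)
  moreover have "idempotent_generated S \<subseteq> \<phi> ` carrier R"
    using ring_iso_memE(5)[OF \<phi>] S.idempotent_generated_subset_carrier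
    by (simp add: bij_betw_def)
  ultimately show ?thesis
    by force
qed

section \<open>Direct products\<close>

lemma monoid_product_ring:
  assumes "\<And>i. i \<in> I \<Longrightarrow> monoid (M i)"
  shows "monoid (product_ring I M)"
  using assms unfolding product_ring_def
  by (intro monoidI)
    (auto simp: PiE_iff extensional_def restrict_def fun_eq_iff monoid.m_assoc monoid.m_closed
      monoid.one_closed monoid.l_one monoid.r_one)

lemma foldr_mult_product_ring:
  "foldr (\<otimes>\<^bsub>product_ring I M\<^esub>) fs \<one>\<^bsub>product_ring I M\<^esub>
    = (\<lambda>i\<in>I. foldr (\<otimes>\<^bsub>M i\<^esub>) (map (\<lambda>f. f i) fs) \<one>\<^bsub>M i\<^esub>)"
  by (induction fs) (auto simp: product_ring_def)

lemma idempotents_product_ring: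
  "idempotents (product_ring I M) = (\<Pi>\<^sub>E i\<in>I. idempotents (M i))"
  by (auto simp: idempotents_def product_ring_def PiE_iff fun_eq_iff extensional_def)

lemma (in monoid) idempotent_factorization_of_length:
  assumes "idempotent_length G x \<le> enat m"
  obtains es where "es \<in> idempotent_factorizations G x" "length es = m"
proof -
  have "idempotent_length G x \<noteq> \<infinity>"
    using assms by (auto dest: enat_ile)
  then obtain es where es: "es \<in> idempotent_factorizations G x" and
    len: "idempotent_length G x = enat (length es)"
    by (rule idempotent_length_attained)
  let ?ones = "replicate (m - length es) \<one>"
  have "foldr (\<otimes>) (replicate j \<one>) \<one> = \<one>" for j
    by (induction j) auto
  then have "es @ ?ones \<in> idempotent_factorizations G x"
    using es by (auto simp: idempotent_factorizations_def idempotents_def)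
  moreover have "length (es @ ?ones) = m"
    using assms len by simp
  ultimately show thesis by (rule that)
qed

lemma idempotent_length_product_ring_le:
  assumes M: "\<And>i. i \<in> I \<Longrightarrow> monoid (M i)" and x: "x \<in> extensional I"
    and len: "\<And>i. i \<in> I \<Longrightarrow> idempotent_length (M i) (x i) \<le> enat m"
  shows "idempotent_length (product_ring I M) x \<le> enat m"
proof -
  have "\<exists>es\<in>idempotent_factorizations (M i) (x i). length es = m" if "i \<in> I" for i
    using monoid.idempotent_factorization_of_length[OF M[OF that] len[OF that]] by blast
  then obtain es where es: "\<And>i. i \<in> I \<Longrightarrow> es i \<in> idempotent_factorizations (M i) (x i)"
    and length: "\<And>i. i \<in> I \<Longrightarrow> length (es i) = m"
    by metis
  define fs where "fs = map (\<lambda>k. \<lambda>i\<in>I. es i ! k) [0..<m]"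
  have component: "map (\<lambda>f. f i) fs = es i" if "i \<in> I" for i
    using that length by (intro nth_equalityI) (auto simp: fs_def)
  have "es i ! k \<in> idempotents (M i)" if "i \<in> I" "k < m" for i k
    using es[OF that(1)] length[OF that(1)] that(2) nth_mem[of k "es i"]
    by (auto simp: idempotent_factorizations_def)
  then have "set fs \<subseteq> idempotents (product_ring I M)"
    by (auto simp: fs_def idempotents_product_ring)
  moreover have "foldr (\<otimes>\<^bsub>product_ring I M\<^esub>) fs \<one>\<^bsub>product_ring I M\<^esub> = x"
    unfolding foldr_mult_product_ring using es component x
    by (auto simp: fun_eq_iff idempotent_factorizations_def extensional_def)
  ultimately have "fs \<in> idempotent_factorizations (product_ring I M) x"
    by (simp add: idempotent_factorizations_def)
  then show ?thesis
    using idempotent_length_le_length[of fs] by (simp add: fs_def)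
qed

theorem idempotent_length_product_ring:
  assumes M: "\<And>i. i \<in> I \<Longrightarrow> monoid (M i)" and x: "x \<in> extensional I"
  shows "idempotent_length (product_ring I M) x = (SUP i\<in>I. idempotent_length (M i) (x i))"
proof (rule antisym)
  interpret monoid "product_ring I M" by (rule monoid_product_ring[OF M])
  show "(SUP i\<in>I. idempotent_length (M i) (x i)) \<le> idempotent_length (product_ring I M) x"
  proof (rule SUP_least)
    fix i assume i: "i \<in> I"
    show "idempotent_length (M i) (x i) \<le> idempotent_length (product_ring I M) x"
      using i by (intro idempotent_length_hom_le[of "\<lambda>x. x i"])
        (auto simp: hom_def product_ring_def)
  qed
  show "idempotent_length (product_ring I M) x \<le> (SUP i\<in>I. idempotent_length (M i) (x i))"
  proof (cases "SUP i\<in>I. idempotent_length (M i) (x i)")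
    case (enat m)
    then have "idempotent_length (M i) (x i) \<le> enat m" if "i \<in> I" for i
      by (metis SUP_upper that)
    then show ?thesis
      unfolding enat by (intro idempotent_length_product_ring_le M x)
  qed simp
qed

theorem idempotent_generated_product_ring:
  assumes "finite I" and M: "\<And>i. i \<in> I \<Longrightarrow> monoid (M i)"
  shows "idempotent_generated (product_ring I M) = (\<Pi>\<^sub>E i\<in>I. idempotent_generated (M i))"
proof -
  interpret P: monoid "product_ring I M" by (rule monoid_product_ring[OF M])
  have "x \<in> extensional I" if "x \<in> idempotent_generated (product_ring I M)" for x
    using that P.idempotent_generated_subset_carrier by (auto simp: product_ring_def PiE_iff)
  moreover have "x \<in> idempotent_generated (product_ring I M)
      \<longleftrightarrow> (\<forall>i\<in>I. x i \<in> idempotent_generated (M i))" if x: "x \<in> extensional I" for x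
  proof -
    have "(SUP i\<in>I. idempotent_length (M i) (x i)) \<noteq> \<infinity>
        \<longleftrightarrow> (\<forall>i\<in>I. idempotent_length (M i) (x i) \<noteq> \<infinity>)"
      using \<open>finite I\<close> by induction (auto simp: sup_max max_def bot_enat_def dest: enat_ile)
    then show ?thesis
      by (simp add: P.idempotent_generated_eq monoid.idempotent_generated_eq[OF M]
          idempotent_length_product_ring[OF M x])
  qed
  ultimately show ?thesis
    unfolding set_eq_iff PiE_iff by blast
qed

corollary idempotent_length_ring_iso_product:
  assumes R: "ring R" and I: "finite I" "I \<noteq> {}" and M: "\<And>i. i \<in> I \<Longrightarrow> monoid (M i)"
    and \<phi>: "\<phi> \<in> ring_iso R (product_ring I M)" and x: "x \<in> carrier R"
  shows "idempotent_length R x = (MAX i\<in>I. idempotent_length (M i) (\<phi> x i))"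
proof -
  have "idempotent_length R x = idempotent_length (product_ring I M) (\<phi> x)"
    by (rule idempotent_length_ring_iso[OF R monoid_product_ring[OF M] \<phi> x, symmetric])
  also have "\<dots> = (SUP i\<in>I. idempotent_length (M i) (\<phi> x i))"
    using ring_iso_memE(1)[OF \<phi> x]
    by (intro idempotent_length_product_ring M) (simp_all add: product_ring_def PiE_iff)
  also have "\<dots> = (MAX i\<in>I. idempotent_length (M i) (\<phi> x i))"
    using I by (intro cSup_eq_Max) simp_all
  finally show ?thesis .
qed

corollary idempotent_generated_ring_iso_product:
  assumes R: "ring R" and I: "finite I" and M: "\<And>i. i \<in> I \<Longrightarrow> monoid (M i)"
    and \<phi>: "\<phi> \<in> ring_iso R (product_ring I M)"
  shows "\<phi> ` idempotent_generated R = (\<Pi>\<^sub>E i\<in>I. idempotent_generated (M i))"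
proof -
  have "\<phi> ` idempotent_generated R = idempotent_generated (product_ring I M)"
    by (rule idempotent_generated_ring_iso[OF R monoid_product_ring[OF M] \<phi>])
  also have "\<dots> = (\<Pi>\<^sub>E i\<in>I. idempotent_generated (M i))"
    by (rule idempotent_generated_product_ring[OF I M])
  finally show ?thesis .
qed

section \<open>Idempotents and zero divisors\<close>

context ring
begin

lemma minus_l_distr:
  assumes "a \<in> carrier R" "b \<in> carrier R" "c \<in> carrier R"
  shows "(a \<ominus> b) \<otimes> c = a \<otimes> c \<ominus> b \<otimes> c"
  using assms by algebra

lemma minus_r_distr:
  assumes "a \<in> carrier R" "b \<in> carrier R" "c \<in> carrier R"
  shows "c \<otimes> (a \<ominus> b) = c \<otimes> a \<ominus> c \<otimes> b"
  using assms by algebra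

lemma minus_zero_right [simp]: "a \<in> carrier R \<Longrightarrow> a \<ominus> \<zero> = a"
  by algebra

lemma minus_self [simp]: "a \<in> carrier R \<Longrightarrow> a \<ominus> a = \<zero>"
  by simp

lemma one_minus_idempotent:
  assumes "x \<in> idempotents R"
  shows "\<one> \<ominus> x \<in> idempotents R"
  using assms by (simp add: idempotents_def minus_l_distr minus_r_distr)

lemma one_minus_mult_idempotent:
  assumes "v \<in> carrier R" "f \<in> carrier R" "f \<otimes> v \<otimes> f = f"
  shows "\<one> \<ominus> v \<otimes> f \<in> idempotents R"
  using assms by (intro one_minus_idempotent) (simp add: idempotents_def m_assoc)

lemma mult_one_minus_factorization:
  assumes "A \<in> carrier R" "v \<in> carrier R" "f \<in> carrier R" "z \<in> carrier R"
    and "A \<otimes> v = \<zero>" and "f \<otimes> v \<otimes> f = f"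
  shows "A = A \<otimes> (\<one> \<oplus> z \<otimes> f) \<otimes> (\<one> \<ominus> v \<otimes> f)"
proof -
  have "f \<otimes> (\<one> \<ominus> v \<otimes> f) = \<zero>" "A \<otimes> (\<one> \<ominus> v \<otimes> f) = A"
    using assms by (simp_all add: minus_r_distr flip: m_assoc)
  then show ?thesis
    using assms by (simp add: l_distr m_assoc)
qed

lemma idempotents_subset_sharp: "idempotents R \<subseteq> carrier (sharp R)"
proof
  fix x assume "x \<in> idempotents R"
  then have x: "x \<in> carrier R" "x \<otimes> x = x"
    by (simp_all add: idempotents_def)
  then have "x \<otimes> (\<one> \<ominus> x) = \<zero>" "(\<one> \<ominus> x) \<otimes> x = \<zero>"
    by (simp_all add: minus_l_distr minus_r_distr)
  moreover have "\<one> \<ominus> x \<noteq> \<zero>" if "x \<noteq> \<one>"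
    using that x(1) by simp
  ultimately have "left_zero_divisor R x \<and> right_zero_divisor R x" if "x \<noteq> \<one>"
    using that x(1) unfolding left_zero_divisor_def right_zero_divisor_def
    by (meson minus_closed one_closed)
  then show "x \<in> carrier (sharp R)"
    by (auto simp: sharp_def)
qed

lemma idempotent_generated_subset_sharp:
  "idempotent_generated R \<subseteq> carrier (sharp R)"
  using submonoid_sharp[OF ring_axioms] idempotents_subset_sharp
  unfolding idempotent_generated_def by blast

lemma idempotent_length_sharp: "idempotent_length (sharp R) x = idempotent_length R x"
proof -
  have "idempotents (sharp R) = idempotents R"
    using idempotents_subset_sharp submonoid.subset[OF submonoid_sharp[OF ring_axioms]]
    by (auto simp: idempotents_def sharp_def)
  then show ?thesis
    by (simp add: idempotent_length_def idempotent_factorizations_def sharp_def)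
qed

end

section \<open>Prime rings with a minimal idempotent\<close>

text \<open>For \<open>R\<close> the ring of matrices over a skew field and \<open>e\<close> the matrix unit \<open>E\<^sub>1\<^sub>1\<close>, the elements
  of \<open>R e\<close> are column vectors, those of \<open>e R\<close> row vectors, and \<open>e R e\<close> is the skew field
  of scalars.\<close>

locale prime_ring_minimal_idempotent = ring R for R (structure) +
  fixes e :: 'a
  assumes e_closed [simp]: "e \<in> carrier R"
    and e_idempotent: "e \<otimes> e = e"
    and e_not_zero: "e \<noteq> \<zero>"
    and prime: "x \<in> carrier R \<Longrightarrow> y \<in> carrier R \<Longrightarrow> (\<And>u. u \<in> carrier R \<Longrightarrow> x \<otimes> u \<otimes> y = \<zero>) \<Longrightarrow>
      x = \<zero> \<or> y = \<zero>"
    and corner_inverse: "d \<in> carrier R \<Longrightarrow> d \<noteq> \<zero> \<Longrightarrow> e \<otimes> d = d \<Longrightarrow> d \<otimes> e = d \<Longrightarrow>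
      \<exists>d'\<in>carrier R. d \<otimes> d' = e"
begin

definition columns :: "'a set"
  where "columns = {u \<in> carrier R. u \<otimes> e = u}"

definition rows :: "'a set"
  where "rows = {g \<in> carrier R. e \<otimes> g = g}"

lemma rowsI: "g \<in> carrier R \<Longrightarrow> e \<otimes> g = g \<Longrightarrow> g \<in> rows"
  by (simp add: rows_def)

lemma mult_column_closed: "x \<in> carrier R \<Longrightarrow> u \<in> columns \<Longrightarrow> x \<otimes> u \<in> columns"
  by (simp add: columns_def m_assoc)

lemma row_mult_closed: "g \<in> rows \<Longrightarrow> x \<in> carrier R \<Longrightarrow> g \<otimes> x \<in> rows"
  by (simp add: rows_def flip: m_assoc)

lemma column_minus_closed: "u \<in> columns \<Longrightarrow> v \<in> columns \<Longrightarrow> u \<ominus> v \<in> columns"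
  by (simp add: columns_def minus_l_distr)

lemma row_add_closed: "g \<in> rows \<Longrightarrow> h \<in> rows \<Longrightarrow> g \<oplus> h \<in> rows"
  by (simp add: rows_def r_distr)

lemma row_minus_closed: "g \<in> rows \<Longrightarrow> h \<in> rows \<Longrightarrow> g \<ominus> h \<in> rows"
  by (simp add: rows_def minus_r_distr)

lemma mult_e_in_columns: "x \<in> carrier R \<Longrightarrow> x \<otimes> e \<in> columns"
  by (simp add: columns_def m_assoc e_idempotent)

lemma e_mult_in_rows: "x \<in> carrier R \<Longrightarrow> e \<otimes> x \<in> rows"
  by (simp add: rows_def e_idempotent flip: m_assoc)

lemma columnsD [simp]:
  assumes "u \<in> columns"
  shows "u \<in> carrier R" "u \<otimes> e = u"
  using assms by (simp_all add: columns_def)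

lemma rowsD [simp]:
  assumes "g \<in> rows"
  shows "g \<in> carrier R" "e \<otimes> g = g"
  using assms by (simp_all add: rows_def)

lemma mult_nonzero_column:
  assumes "x \<in> carrier R" "x \<noteq> \<zero>"
  obtains u where "u \<in> columns" "x \<otimes> u \<noteq> \<zero>"
proof -
  obtain u where "u \<in> carrier R" "x \<otimes> u \<otimes> e \<noteq> \<zero>"
    using prime[of x e] assms e_not_zero by auto
  then show thesis
    using that[of "u \<otimes> e"] assms(1) by (simp add: mult_e_in_columns m_assoc)
qed

lemma nonzero_mult_row:
  assumes "x \<in> carrier R" "x \<noteq> \<zero>"
  obtains g where "g \<in> rows" "g \<otimes> x \<noteq> \<zero>"
proof -
  obtain u where "u \<in> carrier R" "e \<otimes> u \<otimes> x \<noteq> \<zero>"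
    using prime[of e x] assms e_not_zero by auto
  then show thesis
    using that[of "e \<otimes> u"] by (simp add: e_mult_in_rows)
qed

text \<open>A group is not the union of two proper subgroups.\<close>

lemma nonzero_mult_common_row:
  assumes x: "x \<in> carrier R" "x \<noteq> \<zero>" and y: "y \<in> carrier R" "y \<noteq> \<zero>"
  obtains g where "g \<in> rows" "g \<otimes> x \<noteq> \<zero>" "g \<otimes> y \<noteq> \<zero>"
proof -
  obtain g where g: "g \<in> rows" "g \<otimes> x \<noteq> \<zero>" using nonzero_mult_row[OF x] .
  obtain h where h: "h \<in> rows" "h \<otimes> y \<noteq> \<zero>" using nonzero_mult_row[OF y] .
  have "(g \<oplus> h) \<otimes> x = g \<otimes> x \<oplus> h \<otimes> x" "(g \<oplus> h) \<otimes> y = g \<otimes> y \<oplus> h \<otimes> y"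
    using x(1) y(1) g(1) h(1) by (simp_all add: l_distr)
  then consider "g \<otimes> y \<noteq> \<zero>" | "h \<otimes> x \<noteq> \<zero>" | "(g \<oplus> h) \<otimes> x \<noteq> \<zero>" "(g \<oplus> h) \<otimes> y \<noteq> \<zero>"
    using g h x(1) y(1) by (cases "g \<otimes> y = \<zero>"; cases "h \<otimes> x = \<zero>") auto
  then show thesis
  proof cases
    case 1
    then show thesis using g that by simp
  next
    case 2
    then show thesis using h that by simp
  next
    case 3
    then show thesis by (rule that[OF row_add_closed[OF g(1) h(1)]])
  qed
qed

lemma scale_column:
  assumes g: "g \<in> rows" and u: "u \<in> columns" and "g \<otimes> u \<noteq> \<zero>"
  obtains d where "d \<in> columns" "g \<otimes> (u \<otimes> d) = e"
proof -
  have "e \<otimes> (g \<otimes> u) = g \<otimes> u" "g \<otimes> u \<otimes> e = g \<otimes> u"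
    using mult_column_closed[of g u] row_mult_closed[of g u] g u by simp_all
  then obtain d where d: "d \<in> carrier R" "g \<otimes> u \<otimes> d = e"
    using corner_inverse[of "g \<otimes> u"] assms by auto
  have "g \<otimes> (u \<otimes> (d \<otimes> e)) = e"
    using g u d(1) by (simp add: d(2) e_idempotent flip: m_assoc)
  then show thesis
    using that d(1) mult_e_in_columns by blast
qed

text \<open>The rank of \<open>M\<close> is the codimension of its kernel.\<close>

definition rank_le :: "nat \<Rightarrow> 'a \<Rightarrow> bool"
  where "rank_le k M \<longleftrightarrow> M \<in> carrier R \<and>
    (\<exists>F\<subseteq>rows. finite F \<and> card F \<le> k \<and>
      (\<forall>u\<in>carrier R. (\<forall>q\<in>F. q \<otimes> u = \<zero>) \<longrightarrow> M \<otimes> u = \<zero>))"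

lemma rank_le_zero: "rank_le 0 M \<Longrightarrow> M = \<zero>"
  unfolding rank_le_def by (metis card_eq_0_iff empty_iff le_zero_eq one_closed r_one)

lemma kernel_of_projected_rows:
  assumes F: "F \<subseteq> rows" and p: "p \<in> rows" and t: "t \<in> columns" "p \<otimes> t = e"
    and u [simp]: "u \<in> carrier R"
    and projected: "\<And>q. q \<in> F - {p} \<Longrightarrow> (q \<ominus> q \<otimes> t \<otimes> p) \<otimes> u = \<zero>"
  obtains w c where "w \<in> carrier R" "c \<in> carrier R" "u = w \<oplus> t \<otimes> c" "\<And>q. q \<in> F \<Longrightarrow> q \<otimes> w = \<zero>"
proof
  let ?w = "u \<ominus> t \<otimes> (p \<otimes> u)"
  show "?w \<in> carrier R" "p \<otimes> u \<in> carrier R"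
    using p t(1) by simp_all
  show "u = ?w \<oplus> t \<otimes> (p \<otimes> u)"
    using p t(1) by (simp add: minus_eq a_assoc l_neg)
  fix q assume q: "q \<in> F"
  then have "q \<in> carrier R"
    using F by auto
  then have "q \<otimes> ?w = (q \<ominus> q \<otimes> t \<otimes> p) \<otimes> u"
    using p t(1) by (simp add: minus_l_distr minus_r_distr m_assoc)
  moreover have "p \<ominus> p \<otimes> t \<otimes> p = \<zero>"
    using p by (simp add: t(2))
  ultimately show "q \<otimes> ?w = \<zero>"
    using q projected by (cases "q = p") auto
qed

lemma rank_le_of_larger_kernel:
  assumes M: "rank_le (Suc k) M" and N [simp]: "N \<in> carrier R"
    and kernel_mono: "\<And>u. u \<in> carrier R \<Longrightarrow> M \<otimes> u = \<zero> \<Longrightarrow> N \<otimes> u = \<zero>"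
    and x: "x \<in> columns" "M \<otimes> x \<noteq> \<zero>" "N \<otimes> x = \<zero>"
  shows "rank_le k N"
proof -
  obtain F where F: "F \<subseteq> rows" "finite F" "card F \<le> Suc k"
    and kernel: "\<And>u. u \<in> carrier R \<Longrightarrow> (\<And>q. q \<in> F \<Longrightarrow> q \<otimes> u = \<zero>) \<Longrightarrow> M \<otimes> u = \<zero>"
    using M by (auto simp: rank_le_def)
  obtain p where p: "p \<in> F" "p \<otimes> x \<noteq> \<zero>"
    using kernel[of x] x(1,2) by auto
  then obtain d where d: "d \<in> columns" "p \<otimes> (x \<otimes> d) = e"
    using scale_column F(1) x(1) by blast
  have p_row: "p \<in> rows" and xd: "x \<otimes> d \<in> columns"
    using p(1) F(1) x(1) d(1) by (auto intro: mult_column_closed)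
  define project where "project q = q \<ominus> q \<otimes> (x \<otimes> d) \<otimes> p" for q
  have "N \<otimes> u = \<zero>"
    if u: "u \<in> carrier R" and annihilated: "\<And>q. q \<in> project ` (F - {p}) \<Longrightarrow> q \<otimes> u = \<zero>" for u
  proof -
    obtain w c where "w \<in> carrier R" "c \<in> carrier R" "u = w \<oplus> x \<otimes> d \<otimes> c"
      and "\<And>q. q \<in> F \<Longrightarrow> q \<otimes> w = \<zero>"
      using kernel_of_projected_rows[OF F(1) p_row xd d(2) u] annihilated
      unfolding project_def by blast
    moreover from this have "N \<otimes> w = \<zero>"
      by (intro kernel_mono kernel)
    ultimately show ?thesis
      using x(1,3) d(1) by (simp add: r_distr flip: m_assoc)
  qed
  moreover have "project ` (F - {p}) \<subseteq> rows"
    using F(1) p_row xd by (auto simp: project_def intro!: row_minus_closed row_mult_closed)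
  moreover have "card (project ` (F - {p})) \<le> k"
    using F p card_image_le[of "F - {p}" project] by simp
  ultimately show ?thesis
    using F unfolding rank_le_def by (intro conjI exI[of _ "project ` (F - {p})"]) auto
qed

lemma wedderburn_rank_reduction:
  assumes M: "rank_le (Suc k) M" and x: "x \<in> columns" and g: "g \<in> rows"
    and gMx: "g \<otimes> (M \<otimes> x) = e"
  shows "rank_le k (M \<ominus> M \<otimes> x \<otimes> (g \<otimes> M))"
proof (rule rank_le_of_larger_kernel[OF M _ _ x])
  have [simp]: "M \<in> carrier R" "x \<in> carrier R" "g \<in> carrier R"
    using M x g by (auto simp: rank_le_def)
  show "M \<ominus> M \<otimes> x \<otimes> (g \<otimes> M) \<in> carrier R"
    by simp
  show "M \<otimes> x \<noteq> \<zero>"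
    using gMx e_not_zero by auto
  show "(M \<ominus> M \<otimes> x \<otimes> (g \<otimes> M)) \<otimes> x = \<zero>"
    using x by (simp add: minus_l_distr m_assoc gMx)
  show "(M \<ominus> M \<otimes> x \<otimes> (g \<otimes> M)) \<otimes> u = \<zero>" if "u \<in> carrier R" "M \<otimes> u = \<zero>" for u
    using that by (simp add: minus_l_distr m_assoc)
qed

lemma left_zero_divisor_mult_one_plus:
  assumes A [simp]: "A \<in> carrier R" and v: "v \<in> columns" and z: "z \<in> columns" and f: "f \<in> rows"
    and Av: "A \<otimes> v = \<zero>" and fv: "f \<otimes> v = e"
  shows "left_zero_divisor R (A \<otimes> (\<one> \<oplus> z \<otimes> f))"
proof -
  define b where "b = z \<ominus> v \<otimes> (f \<otimes> z \<oplus> e)"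
  have b [simp]: "b \<in> carrier R"
    using v z f by (simp add: b_def)
  have "f \<otimes> z \<oplus> e \<in> rows"
    using z f by (intro row_add_closed row_mult_closed) (simp_all add: rowsI e_idempotent)
  then have "f \<otimes> v \<otimes> (f \<otimes> z \<oplus> e) = f \<otimes> z \<oplus> e"
    unfolding fv by (rule rowsD)
  then have "f \<otimes> b = f \<otimes> z \<ominus> (f \<otimes> z \<oplus> e)"
    using v z f by (simp add: b_def minus_r_distr m_assoc)
  also have "\<dots> = \<ominus> e"
    using z f by (simp add: minus_eq minus_add r_neg2)
  finally have fb: "f \<otimes> b = \<ominus> e" .
  then have "b \<noteq> \<zero>"
    using e_not_zero f by (metis e_closed minus_minus minus_zero r_null rowsD(1))
  have "(\<one> \<oplus> z \<otimes> f) \<otimes> b = b \<ominus> z"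
    using z f by (simp add: l_distr m_assoc fb r_minus minus_eq)
  also have "\<dots> = \<ominus> (v \<otimes> (f \<otimes> z \<oplus> e))"
    using v z f by (simp add: b_def minus_eq a_ac r_neg2)
  finally have "A \<otimes> (\<one> \<oplus> z \<otimes> f) \<otimes> b = \<ominus> (A \<otimes> v \<otimes> (f \<otimes> z \<oplus> e))"
    using v z f by (simp add: m_assoc r_minus)
  then have "A \<otimes> (\<one> \<oplus> z \<otimes> f) \<otimes> b = \<zero>"
    using z f by (simp add: Av)
  with b \<open>b \<noteq> \<zero>\<close> show ?thesis
    using z f by (auto simp: left_zero_divisor_def)
qed

lemma split_off_idempotent:
  assumes A [simp]: "A \<in> carrier R" and v: "v \<in> columns" and y: "y \<in> columns" and g: "g \<in> rows"
    and Av: "A \<otimes> v = \<zero>" and gv: "g \<otimes> v = e"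
  obtains B E where "E \<in> idempotents R" "left_zero_divisor R B" "A = B \<otimes> E"
    "\<one> \<ominus> B = (\<one> \<ominus> A) \<ominus> (\<one> \<ominus> A) \<otimes> (A \<otimes> y) \<otimes> (g \<otimes> (\<one> \<ominus> A))"
proof
  define f where "f = g \<otimes> (\<one> \<ominus> A)"
  define z where "z = y \<ominus> A \<otimes> y"
  have f: "f \<in> rows" and z: "z \<in> columns"
    using g y by (simp_all add: f_def z_def row_mult_closed column_minus_closed mult_column_closed)
  have fv: "f \<otimes> v = e"
    using g v by (simp add: f_def minus_l_distr minus_r_distr m_assoc Av gv)
  then have fvf: "f \<otimes> v \<otimes> f = f"
    using f by simp
  show "\<one> \<ominus> v \<otimes> f \<in> idempotents R"
    using f v fvf by (simp add: one_minus_mult_idempotent)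
  show "A = A \<otimes> (\<one> \<oplus> z \<otimes> f) \<otimes> (\<one> \<ominus> v \<otimes> f)"
    using f v z fvf Av by (simp add: mult_one_minus_factorization)
  show "left_zero_divisor R (A \<otimes> (\<one> \<oplus> z \<otimes> f))"
    using left_zero_divisor_mult_one_plus[OF A v z f Av fv] .
  have "(\<one> \<ominus> A) \<otimes> (A \<otimes> y) \<otimes> f = A \<otimes> z \<otimes> f"
    using y by (simp add: z_def minus_l_distr minus_r_distr)
  then show "\<one> \<ominus> A \<otimes> (\<one> \<oplus> z \<otimes> f)
      = (\<one> \<ominus> A) \<ominus> (\<one> \<ominus> A) \<otimes> (A \<otimes> y) \<otimes> (g \<otimes> (\<one> \<ominus> A))"
    unfolding f_def[symmetric] using f z by (simp add: r_distr m_assoc minus_eq minus_add a_assoc)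
qed

lemma split_off_idempotent_rank:
  assumes rank: "rank_le (Suc k) (\<one> \<ominus> A)" and A: "left_zero_divisor R A" "A \<notin> idempotents R"
  obtains B E where "E \<in> idempotents R" "left_zero_divisor R B" "A = B \<otimes> E" "rank_le k (\<one> \<ominus> B)"
proof -
  obtain b where A_closed [simp]: "A \<in> carrier R" and b: "b \<in> carrier R" "b \<noteq> \<zero>" "A \<otimes> b = \<zero>"
    using A(1) by (auto simp: left_zero_divisor_def)
  obtain s where s: "s \<in> columns" "b \<otimes> s \<noteq> \<zero>"
    using mult_nonzero_column[OF b(1,2)] .
  have "A \<ominus> A \<otimes> A \<noteq> \<zero>"
    using A(2) by (auto simp: idempotents_def)
  then obtain t where t: "t \<in> columns" "(A \<ominus> A \<otimes> A) \<otimes> t \<noteq> \<zero>"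
    using mult_nonzero_column[of "A \<ominus> A \<otimes> A"] by auto
  then have not_fixed: "(\<one> \<ominus> A) \<otimes> (A \<otimes> t) \<noteq> \<zero>"
    by (simp add: minus_l_distr m_assoc)
  obtain g where g: "g \<in> rows" "g \<otimes> (b \<otimes> s) \<noteq> \<zero>" "g \<otimes> ((\<one> \<ominus> A) \<otimes> (A \<otimes> t)) \<noteq> \<zero>"
    using nonzero_mult_common_row[OF _ s(2) _ not_fixed] b(1) s(1) t(1) by auto
  obtain c where c: "c \<in> columns" "g \<otimes> (b \<otimes> s \<otimes> c) = e"
    using scale_column[OF g(1) _ g(2)] b(1) s(1) mult_column_closed by blast
  obtain d where d: "d \<in> columns" "g \<otimes> ((\<one> \<ominus> A) \<otimes> (A \<otimes> t) \<otimes> d) = e"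
    using scale_column[OF g(1) _ g(3)] t(1) mult_column_closed by auto
  have v: "b \<otimes> s \<otimes> c \<in> columns" "A \<otimes> (b \<otimes> s \<otimes> c) = \<zero>"
    using b s c by (simp_all add: mult_column_closed flip: m_assoc)
  have y: "t \<otimes> d \<in> columns" "g \<otimes> ((\<one> \<ominus> A) \<otimes> (A \<otimes> (t \<otimes> d))) = e"
    using t(1) d by (simp_all add: mult_column_closed m_assoc)
  obtain B E where "E \<in> idempotents R" "left_zero_divisor R B" "A = B \<otimes> E"
    and "\<one> \<ominus> B = (\<one> \<ominus> A) \<ominus> (\<one> \<ominus> A) \<otimes> (A \<otimes> (t \<otimes> d)) \<otimes> (g \<otimes> (\<one> \<ominus> A))"
    by (rule split_off_idempotent[OF A_closed v(1) y(1) g(1) v(2) c(2)])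
  moreover have "A \<otimes> (t \<otimes> d) \<in> columns"
    using y(1) by (simp add: mult_column_closed)
  ultimately show thesis
    using that wedderburn_rank_reduction[OF rank _ g(1) y(2)] by simp
qed

theorem idempotent_length_le_rank:
  assumes "rank_le k (\<one> \<ominus> A)" "left_zero_divisor R A"
  shows "idempotent_length R A \<le> enat k"
  using assms
proof (induction k arbitrary: A)
  case 0
  then have "A \<in> carrier R" "\<one> \<ominus> A = \<zero>"
    by (simp_all add: left_zero_divisor_def rank_le_zero)
  then have "A = \<one>" by simp
  then show ?case
    by (simp add: idempotent_length_one)
next
  case (Suc k)
  show ?case
  proof (cases "A \<in> idempotents R")
    case True
    then show ?thesis
      using idempotent_length_idempotent_le[of A] by (simp add: order_trans one_enat_def)
  next
    case False
    then obtain B E where "E \<in> idempotents R" "left_zero_divisor R B" and A: "A = B \<otimes> E"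
      and "rank_le k (\<one> \<ominus> B)"
      using split_off_idempotent_rank[OF Suc.prems] by blast
    then have "idempotent_length R B + idempotent_length R E \<le> enat k + 1"
      by (intro add_mono Suc.IH idempotent_length_idempotent_le)
    then show ?thesis
      using idempotent_length_mult_le[of B E] by (simp add: A eSuc_enat flip: eSuc_plus_1)
  qed
qed

end

section \<open>Matrix rings\<close>

lemma (in abelian_monoid) finsum_swap:
  assumes "finite A" "finite B" "\<And>i j. i \<in> A \<Longrightarrow> j \<in> B \<Longrightarrow> f i j \<in> carrier G"
  shows "(\<Oplus>i\<in>A. \<Oplus>j\<in>B. f i j) = (\<Oplus>j\<in>B. \<Oplus>i\<in>A. f i j)"
  using assms(1,3)
proof (induction A)
  case empty
  then show ?case by simp
next
  case (insert a A)
  have "(\<Oplus>i\<in>insert a A. \<Oplus>j\<in>B. f i j) = (\<Oplus>j\<in>B. f a j) \<oplus> (\<Oplus>j\<in>B. \<Oplus>i\<in>A. f i j)"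
    using insert by (subst finsum_insert) (auto intro!: finsum_closed)
  also have "\<dots> = (\<Oplus>j\<in>B. f a j \<oplus> (\<Oplus>i\<in>A. f i j))"
    using insert.prems by (intro finsum_addf[symmetric]) (auto intro!: finsum_closed)
  also have "\<dots> = (\<Oplus>j\<in>B. \<Oplus>i\<in>insert a A. f i j)"
    using insert by (intro finsum_cong') (auto intro!: finsum_closed)
  finally show ?case .
qed

lemma mat_eqI:
  assumes "A \<in> carrier (mat_ring n D)" "B \<in> carrier (mat_ring n D)"
    and "\<And>i j. i \<in> {1..n} \<Longrightarrow> j \<in> {1..n} \<Longrightarrow> A (i, j) = B (i, j)"
  shows "A = B"
  using assms by (intro PiE_ext[of A "{1..n} \<times> {1..n}" _ B]) (auto simp: mat_ring_def)

lemma mat_entry_closed: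
  "A \<in> carrier (mat_ring n D) \<Longrightarrow> i \<in> {1..n} \<Longrightarrow> j \<in> {1..n} \<Longrightarrow> A (i, j) \<in> carrier D"
  by (auto simp: mat_ring_def)

definition mat_unit :: "nat \<Rightarrow> ('a, 'm) ring_scheme \<Rightarrow> nat \<Rightarrow> nat \<Rightarrow> 'a \<Rightarrow> nat \<times> nat \<Rightarrow> 'a"
  where "mat_unit n D s t a =
    (\<lambda>(i, j) \<in> {1..n} \<times> {1..n}. if i = s \<and> j = t then a else \<zero>\<^bsub>D\<^esub>)"

lemma mat_entry_simps:
  assumes "i \<in> {1..n}" "j \<in> {1..n}"
  shows mat_mult_entry:
      "(A \<otimes>\<^bsub>mat_ring n D\<^esub> B) (i, j) = (\<Oplus>\<^bsub>D\<^esub>l\<in>{1..n}. A (i, l) \<otimes>\<^bsub>D\<^esub> B (l, j))"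
    and mat_add_entry: "(A \<oplus>\<^bsub>mat_ring n D\<^esub> B) (i, j) = A (i, j) \<oplus>\<^bsub>D\<^esub> B (i, j)"
    and mat_one_entry: "\<one>\<^bsub>mat_ring n D\<^esub> (i, j) = (if i = j then \<one>\<^bsub>D\<^esub> else \<zero>\<^bsub>D\<^esub>)"
    and mat_zero_entry: "\<zero>\<^bsub>mat_ring n D\<^esub> (i, j) = \<zero>\<^bsub>D\<^esub>"
    and mat_unit_entry: "mat_unit n D s t a (i, j) = (if i = s \<and> j = t then a else \<zero>\<^bsub>D\<^esub>)"
  using assms by (simp_all add: mat_ring_def mat_unit_def)

context ring
begin

lemma mat_mult_closed:
  assumes "A \<in> carrier (mat_ring n R)" "B \<in> carrier (mat_ring n R)"
  shows "A \<otimes>\<^bsub>mat_ring n R\<^esub> B \<in> carrier (mat_ring n R)"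
proof -
  have "(\<Oplus>l\<in>{1..n}. A (i, l) \<otimes> B (l, j)) \<in> carrier R" if "i \<in> {1..n}" "j \<in> {1..n}" for i j
    using that assms[THEN mat_entry_closed] by (intro finsum_closed) simp
  then show ?thesis by (auto simp: mat_ring_def)
qed

lemma mat_add_closed:
  assumes "A \<in> carrier (mat_ring n R)" "B \<in> carrier (mat_ring n R)"
  shows "A \<oplus>\<^bsub>mat_ring n R\<^esub> B \<in> carrier (mat_ring n R)"
  using assms[THEN mat_entry_closed] by (auto simp: mat_ring_def)

lemma mat_zero_closed: "\<zero>\<^bsub>mat_ring n R\<^esub> \<in> carrier (mat_ring n R)"
  by (auto simp: mat_ring_def)

lemma mat_one_closed: "\<one>\<^bsub>mat_ring n R\<^esub> \<in> carrier (mat_ring n R)"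
  by (auto simp: mat_ring_def)

lemma mat_unit_closed: "a \<in> carrier R \<Longrightarrow> mat_unit n R s t a \<in> carrier (mat_ring n R)"
  by (auto simp: mat_ring_def mat_unit_def)

lemmas mat_closed = mat_mult_closed mat_add_closed mat_zero_closed mat_one_closed mat_unit_closed

lemma mat_mult_assoc:
  assumes A: "A \<in> carrier (mat_ring n R)" and B: "B \<in> carrier (mat_ring n R)"
    and C: "C \<in> carrier (mat_ring n R)"
  shows "A \<otimes>\<^bsub>mat_ring n R\<^esub> B \<otimes>\<^bsub>mat_ring n R\<^esub> C = A \<otimes>\<^bsub>mat_ring n R\<^esub> (B \<otimes>\<^bsub>mat_ring n R\<^esub> C)"
proof (rule mat_eqI)
  fix i j assume ij: "i \<in> {1..n}" "j \<in> {1..n}"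
  note entries_closed = A[THEN mat_entry_closed] B[THEN mat_entry_closed] C[THEN mat_entry_closed]
  have "(A \<otimes>\<^bsub>mat_ring n R\<^esub> B \<otimes>\<^bsub>mat_ring n R\<^esub> C) (i, j)
      = (\<Oplus>l\<in>{1..n}. (\<Oplus>m\<in>{1..n}. A (i, m) \<otimes> B (m, l)) \<otimes> C (l, j))"
    using ij entries_closed unfolding mat_mult_entry[OF ij]
    by (intro finsum_cong') (auto simp: mat_mult_entry intro!: finsum_closed)
  also have "\<dots> = (\<Oplus>l\<in>{1..n}. \<Oplus>m\<in>{1..n}. A (i, m) \<otimes> B (m, l) \<otimes> C (l, j))"
    using ij entries_closed by (intro finsum_cong' finsum_ldistr) (auto intro!: finsum_closed)
  also have "\<dots> = (\<Oplus>m\<in>{1..n}. \<Oplus>l\<in>{1..n}. A (i, m) \<otimes> B (m, l) \<otimes> C (l, j))"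
    using ij entries_closed by (intro finsum_swap) auto
  also have "\<dots> = (\<Oplus>m\<in>{1..n}. \<Oplus>l\<in>{1..n}. A (i, m) \<otimes> (B (m, l) \<otimes> C (l, j)))"
    using ij entries_closed by (intro finsum_cong') (auto simp: m_assoc intro!: finsum_closed)
  also have "\<dots> = (\<Oplus>m\<in>{1..n}. A (i, m) \<otimes> (\<Oplus>l\<in>{1..n}. B (m, l) \<otimes> C (l, j)))"
    using ij entries_closed
    by (intro finsum_cong' finsum_rdistr[symmetric]) (auto intro!: finsum_closed)
  also have "\<dots> = (A \<otimes>\<^bsub>mat_ring n R\<^esub> (B \<otimes>\<^bsub>mat_ring n R\<^esub> C)) (i, j)"
    using ij entries_closed unfolding mat_mult_entry[OF ij]
    by (intro finsum_cong') (auto simp: mat_mult_entry intro!: finsum_closed)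
  finally show "(A \<otimes>\<^bsub>mat_ring n R\<^esub> B \<otimes>\<^bsub>mat_ring n R\<^esub> C) (i, j)
      = (A \<otimes>\<^bsub>mat_ring n R\<^esub> (B \<otimes>\<^bsub>mat_ring n R\<^esub> C)) (i, j)" .
qed (use assms in \<open>auto intro!: mat_mult_closed\<close>)

lemma mat_unit_mult_entry:
  assumes A: "A \<in> carrier (mat_ring n R)" and "a \<in> carrier R" "t \<in> {1..n}" "i \<in> {1..n}" "j \<in> {1..n}"
  shows "(mat_unit n R s t a \<otimes>\<^bsub>mat_ring n R\<^esub> A) (i, j) = (if i = s then a \<otimes> A (t, j) else \<zero>)"
proof -
  have "(mat_unit n R s t a \<otimes>\<^bsub>mat_ring n R\<^esub> A) (i, j)
      = (\<Oplus>l\<in>{1..n}. if t = l then (if i = s then a \<otimes> A (l, j) else \<zero>) else \<zero>)"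
    using assms A[THEN mat_entry_closed]
    by (subst mat_mult_entry, simp, simp, intro finsum_cong') (auto simp: mat_unit_entry)
  also have "\<dots> = (if i = s then a \<otimes> A (t, j) else \<zero>)"
    using assms A[THEN mat_entry_closed] by (subst finsum_singleton) auto
  finally show ?thesis .
qed

lemma mult_mat_unit_entry:
  assumes A: "A \<in> carrier (mat_ring n R)" and "a \<in> carrier R" "s \<in> {1..n}" "i \<in> {1..n}" "j \<in> {1..n}"
  shows "(A \<otimes>\<^bsub>mat_ring n R\<^esub> mat_unit n R s t a) (i, j) = (if j = t then A (i, s) \<otimes> a else \<zero>)"
proof -
  have "(A \<otimes>\<^bsub>mat_ring n R\<^esub> mat_unit n R s t a) (i, j)
      = (\<Oplus>l\<in>{1..n}. if s = l then (if j = t then A (i, l) \<otimes> a else \<zero>) else \<zero>)"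
    using assms A[THEN mat_entry_closed]
    by (subst mat_mult_entry, simp, simp, intro finsum_cong') (auto simp: mat_unit_entry)
  also have "\<dots> = (if j = t then A (i, s) \<otimes> a else \<zero>)"
    using assms A[THEN mat_entry_closed] by (subst finsum_singleton) auto
  finally show ?thesis .
qed

lemma mult_mat_unit_mult_entry:
  assumes A: "A \<in> carrier (mat_ring n R)" and B: "B \<in> carrier (mat_ring n R)" and a: "a \<in> carrier R"
    and st: "s \<in> {1..n}" "t \<in> {1..n}" and ij: "i \<in> {1..n}" "j \<in> {1..n}"
  shows "(A \<otimes>\<^bsub>mat_ring n R\<^esub> mat_unit n R s t a \<otimes>\<^bsub>mat_ring n R\<^esub> B) (i, j) = A (i, s) \<otimes> a \<otimes> B (t, j)"
proof -
  note entries_closed = A[THEN mat_entry_closed] B[THEN mat_entry_closed]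
  have "(A \<otimes>\<^bsub>mat_ring n R\<^esub> mat_unit n R s t a \<otimes>\<^bsub>mat_ring n R\<^esub> B) (i, j)
      = (\<Oplus>l\<in>{1..n}. if t = l then A (i, s) \<otimes> a \<otimes> B (l, j) else \<zero>)"
    unfolding mat_mult_entry[OF ij] using entries_closed a st ij
    by (intro finsum_cong') (auto simp: mult_mat_unit_entry[OF A])
  also have "\<dots> = A (i, s) \<otimes> a \<otimes> B (t, j)"
    using entries_closed a st ij by (intro finsum_singleton) auto
  finally show ?thesis .
qed

lemma mat_mult_one:
  assumes A: "A \<in> carrier (mat_ring n R)"
  shows "\<one>\<^bsub>mat_ring n R\<^esub> \<otimes>\<^bsub>mat_ring n R\<^esub> A = A" "A \<otimes>\<^bsub>mat_ring n R\<^esub> \<one>\<^bsub>mat_ring n R\<^esub> = A"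
proof -
  note entry_closed = A[THEN mat_entry_closed]
  have left: "(\<one>\<^bsub>mat_ring n R\<^esub> \<otimes>\<^bsub>mat_ring n R\<^esub> A) (i, j) = A (i, j)"
    and right: "(A \<otimes>\<^bsub>mat_ring n R\<^esub> \<one>\<^bsub>mat_ring n R\<^esub>) (i, j) = A (i, j)"
    if ij: "i \<in> {1..n}" "j \<in> {1..n}" for i j
  proof -
    have "(\<one>\<^bsub>mat_ring n R\<^esub> \<otimes>\<^bsub>mat_ring n R\<^esub> A) (i, j) = (\<Oplus>l\<in>{1..n}. if i = l then A (l, j) else \<zero>)"
      unfolding mat_mult_entry[OF ij] using ij entry_closed
      by (intro finsum_cong') (auto simp: mat_one_entry)
    also have "\<dots> = A (i, j)"
      using ij entry_closed by (intro finsum_singleton) auto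
    finally show "(\<one>\<^bsub>mat_ring n R\<^esub> \<otimes>\<^bsub>mat_ring n R\<^esub> A) (i, j) = A (i, j)" .
    have "(A \<otimes>\<^bsub>mat_ring n R\<^esub> \<one>\<^bsub>mat_ring n R\<^esub>) (i, j) = (\<Oplus>l\<in>{1..n}. if j = l then A (i, l) else \<zero>)"
      unfolding mat_mult_entry[OF ij] using ij entry_closed
      by (intro finsum_cong') (auto simp: mat_one_entry)
    also have "\<dots> = A (i, j)"
      using ij entry_closed by (intro finsum_singleton) auto
    finally show "(A \<otimes>\<^bsub>mat_ring n R\<^esub> \<one>\<^bsub>mat_ring n R\<^esub>) (i, j) = A (i, j)" .
  qed
  show "\<one>\<^bsub>mat_ring n R\<^esub> \<otimes>\<^bsub>mat_ring n R\<^esub> A = A"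
    by (intro mat_eqI[of _ n R] mat_closed A left)
  show "A \<otimes>\<^bsub>mat_ring n R\<^esub> \<one>\<^bsub>mat_ring n R\<^esub> = A"
    by (intro mat_eqI[of _ n R] mat_closed A right)
qed

lemma monoid_mat_ring: "monoid (mat_ring n R)"
  by (rule monoidI) (auto intro: mat_closed mat_mult_assoc mat_mult_one)

lemma abelian_group_mat_ring: "abelian_group (mat_ring n R)"
proof (rule abelian_groupI)
  fix A assume A: "A \<in> carrier (mat_ring n R)"
  define B where "B = (\<lambda>(i, j) \<in> {1..n} \<times> {1..n}. \<ominus> A (i, j))"
  have B: "B \<in> carrier (mat_ring n R)"
    using A by (auto simp: B_def mat_ring_def)
  have "B \<oplus>\<^bsub>mat_ring n R\<^esub> A = \<zero>\<^bsub>mat_ring n R\<^esub>"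
    using A[THEN mat_entry_closed]
    by (intro mat_eqI[of _ n R] mat_closed A B) (simp add: B_def mat_entry_simps l_neg)
  with B show "\<exists>B\<in>carrier (mat_ring n R). B \<oplus>\<^bsub>mat_ring n R\<^esub> A = \<zero>\<^bsub>mat_ring n R\<^esub>" by blast
next
  fix A B C
  assume carrier: "A \<in> carrier (mat_ring n R)" "B \<in> carrier (mat_ring n R)"
    "C \<in> carrier (mat_ring n R)"
  show "A \<oplus>\<^bsub>mat_ring n R\<^esub> B \<oplus>\<^bsub>mat_ring n R\<^esub> C = A \<oplus>\<^bsub>mat_ring n R\<^esub> (B \<oplus>\<^bsub>mat_ring n R\<^esub> C)"
    using carrier[THEN mat_entry_closed]
    by (intro mat_eqI[of _ n R] mat_closed carrier) (simp add: mat_entry_simps a_assoc)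
qed (auto intro!: mat_eqI[of _ n R] mat_closed simp: mat_entry_simps mat_entry_closed a_comm)

lemma mat_l_distr:
  assumes carrier: "A \<in> carrier (mat_ring n R)" "B \<in> carrier (mat_ring n R)"
    "C \<in> carrier (mat_ring n R)"
  shows "(A \<oplus>\<^bsub>mat_ring n R\<^esub> B) \<otimes>\<^bsub>mat_ring n R\<^esub> C
    = A \<otimes>\<^bsub>mat_ring n R\<^esub> C \<oplus>\<^bsub>mat_ring n R\<^esub> B \<otimes>\<^bsub>mat_ring n R\<^esub> C"
proof (intro mat_eqI[of _ n R] mat_closed carrier)
  fix i j assume ij: "i \<in> {1..n}" "j \<in> {1..n}"
  note entries_closed = carrier[THEN mat_entry_closed]
  have "((A \<oplus>\<^bsub>mat_ring n R\<^esub> B) \<otimes>\<^bsub>mat_ring n R\<^esub> C) (i, j)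
      = (\<Oplus>l\<in>{1..n}. A (i, l) \<otimes> C (l, j) \<oplus> B (i, l) \<otimes> C (l, j))"
    unfolding mat_mult_entry[OF ij] using ij entries_closed
    by (intro finsum_cong') (auto simp: mat_add_entry l_distr)
  also have "\<dots> = (A \<otimes>\<^bsub>mat_ring n R\<^esub> C \<oplus>\<^bsub>mat_ring n R\<^esub> B \<otimes>\<^bsub>mat_ring n R\<^esub> C) (i, j)"
    unfolding mat_mult_entry[OF ij] mat_add_entry[OF ij] using ij entries_closed
    by (intro finsum_addf) auto
  finally show "((A \<oplus>\<^bsub>mat_ring n R\<^esub> B) \<otimes>\<^bsub>mat_ring n R\<^esub> C) (i, j)
      = (A \<otimes>\<^bsub>mat_ring n R\<^esub> C \<oplus>\<^bsub>mat_ring n R\<^esub> B \<otimes>\<^bsub>mat_ring n R\<^esub> C) (i, j)" .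
qed

lemma mat_r_distr:
  assumes carrier: "A \<in> carrier (mat_ring n R)" "B \<in> carrier (mat_ring n R)"
    "C \<in> carrier (mat_ring n R)"
  shows "C \<otimes>\<^bsub>mat_ring n R\<^esub> (A \<oplus>\<^bsub>mat_ring n R\<^esub> B)
    = C \<otimes>\<^bsub>mat_ring n R\<^esub> A \<oplus>\<^bsub>mat_ring n R\<^esub> C \<otimes>\<^bsub>mat_ring n R\<^esub> B"
proof (intro mat_eqI[of _ n R] mat_closed carrier)
  fix i j assume ij: "i \<in> {1..n}" "j \<in> {1..n}"
  note entries_closed = carrier[THEN mat_entry_closed]
  have "(C \<otimes>\<^bsub>mat_ring n R\<^esub> (A \<oplus>\<^bsub>mat_ring n R\<^esub> B)) (i, j)
      = (\<Oplus>l\<in>{1..n}. C (i, l) \<otimes> A (l, j) \<oplus> C (i, l) \<otimes> B (l, j))"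
    unfolding mat_mult_entry[OF ij] using ij entries_closed
    by (intro finsum_cong') (auto simp: mat_add_entry r_distr)
  also have "\<dots> = (C \<otimes>\<^bsub>mat_ring n R\<^esub> A \<oplus>\<^bsub>mat_ring n R\<^esub> C \<otimes>\<^bsub>mat_ring n R\<^esub> B) (i, j)"
    unfolding mat_mult_entry[OF ij] mat_add_entry[OF ij] using ij entries_closed
    by (intro finsum_addf) auto
  finally show "(C \<otimes>\<^bsub>mat_ring n R\<^esub> (A \<oplus>\<^bsub>mat_ring n R\<^esub> B)) (i, j)
      = (C \<otimes>\<^bsub>mat_ring n R\<^esub> A \<oplus>\<^bsub>mat_ring n R\<^esub> C \<otimes>\<^bsub>mat_ring n R\<^esub> B) (i, j)" .
qed

lemma ring_mat_ring: "ring (mat_ring n R)"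
  by (intro ringI abelian_group_mat_ring monoid_mat_ring mat_l_distr mat_r_distr)

end

section \<open>Matrices over skew fields\<close>

lemma skew_field_mult_eq_zero:
  assumes D: "skew_field D" and ab: "a \<in> carrier D" "b \<in> carrier D" "a \<otimes>\<^bsub>D\<^esub> b = \<zero>\<^bsub>D\<^esub>"
  shows "a = \<zero>\<^bsub>D\<^esub> \<or> b = \<zero>\<^bsub>D\<^esub>"
proof -
  interpret ring D using D by (simp add: skew_field_def)
  have "a \<in> Units D" if "a \<noteq> \<zero>\<^bsub>D\<^esub>"
    using D ab(1) that by (simp add: skew_field_def)
  then show ?thesis
    using ab Units_l_cancel[of a b "\<zero>\<^bsub>D\<^esub>"] by auto
qed

lemma mat_ring_prime:
  assumes D: "skew_field D"
    and A: "A \<in> carrier (mat_ring n D)" and B: "B \<in> carrier (mat_ring n D)"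
    and annihilates: "\<And>U. U \<in> carrier (mat_ring n D) \<Longrightarrow>
      A \<otimes>\<^bsub>mat_ring n D\<^esub> U \<otimes>\<^bsub>mat_ring n D\<^esub> B = \<zero>\<^bsub>mat_ring n D\<^esub>"
  shows "A = \<zero>\<^bsub>mat_ring n D\<^esub> \<or> B = \<zero>\<^bsub>mat_ring n D\<^esub>"
proof (rule ccontr)
  interpret ring D using D by (simp add: skew_field_def)
  assume nonzero: "\<not> (A = \<zero>\<^bsub>mat_ring n D\<^esub> \<or> B = \<zero>\<^bsub>mat_ring n D\<^esub>)"
  obtain i s where A_is: "i \<in> {1..n}" "s \<in> {1..n}" "A (i, s) \<noteq> \<zero>\<^bsub>D\<^esub>"
    using nonzero mat_eqI[OF A mat_zero_closed] by (auto simp: mat_zero_entry)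
  obtain t j where B_tj: "t \<in> {1..n}" "j \<in> {1..n}" "B (t, j) \<noteq> \<zero>\<^bsub>D\<^esub>"
    using nonzero mat_eqI[OF B mat_zero_closed] by (auto simp: mat_zero_entry)
  have entries: "A (i, s) \<in> carrier D" "B (t, j) \<in> carrier D"
    using mat_entry_closed[OF A A_is(1,2)] mat_entry_closed[OF B B_tj(1,2)] .
  have "A (i, s) \<otimes>\<^bsub>D\<^esub> B (t, j)
      = (A \<otimes>\<^bsub>mat_ring n D\<^esub> mat_unit n D s t \<one>\<^bsub>D\<^esub> \<otimes>\<^bsub>mat_ring n D\<^esub> B) (i, j)"
    using A_is B_tj entries by (simp add: mult_mat_unit_mult_entry[OF A B])
  also have "\<dots> = \<zero>\<^bsub>D\<^esub>"
    unfolding annihilates[OF mat_unit_closed[OF one_closed]]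
    using A_is B_tj by (simp add: mat_zero_entry)
  finally show False
    using skew_field_mult_eq_zero[OF D entries] A_is(3) B_tj(3) by blast
qed

lemma mat_ring_corner_inverse:
  fixes D :: "('a, 'm) ring_scheme" and n :: nat
  defines "e \<equiv> mat_unit n D 1 1 \<one>\<^bsub>D\<^esub>"
  assumes D: "skew_field D" and n: "1 \<le> n"
    and A: "A \<in> carrier (mat_ring n D)" "A \<noteq> \<zero>\<^bsub>mat_ring n D\<^esub>"
    and eA: "e \<otimes>\<^bsub>mat_ring n D\<^esub> A = A" and Ae: "A \<otimes>\<^bsub>mat_ring n D\<^esub> e = A"
  shows "\<exists>B\<in>carrier (mat_ring n D). A \<otimes>\<^bsub>mat_ring n D\<^esub> B = e"
proof -
  interpret ring D using D by (simp add: skew_field_def)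
  have one_index: "1 \<in> {1..n}" using n by simp
  define a where "a = A (1, 1)"
  have a: "a \<in> carrier D"
    using mat_entry_closed[OF A(1) one_index one_index] by (simp add: a_def)
  have A_entry: "A (i, j) = (if i = 1 \<and> j = 1 then a else \<zero>\<^bsub>D\<^esub>)"
    if "i \<in> {1..n}" "j \<in> {1..n}" for i j
    using mat_unit_mult_entry[OF A(1) one_closed one_index that, of 1]
      mult_mat_unit_entry[OF A(1) one_closed one_index that, of 1] eA Ae by (auto simp: a_def e_def)
  then have "a \<noteq> \<zero>\<^bsub>D\<^esub>"
    using A(2) mat_eqI[OF A(1) mat_zero_closed] by (auto simp: mat_zero_entry)
  then have "a \<in> Units D"
    using D a by (simp add: skew_field_def)
  then obtain b where b: "b \<in> carrier D" "a \<otimes>\<^bsub>D\<^esub> b = \<one>\<^bsub>D\<^esub>"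
    by (auto simp: Units_def)
  have "A \<otimes>\<^bsub>mat_ring n D\<^esub> mat_unit n D 1 1 b = e"
    unfolding e_def using A(1) b one_index
    by (intro mat_eqI[of _ n D] mat_closed)
      (auto simp: mult_mat_unit_entry mat_unit_entry A_entry)
  then show ?thesis
    using b mat_unit_closed by blast
qed

lemma prime_ring_minimal_idempotent_mat_ring:
  assumes D: "skew_field D" and n: "1 \<le> n"
  shows "prime_ring_minimal_idempotent (mat_ring n D) (mat_unit n D 1 1 \<one>\<^bsub>D\<^esub>)"
proof -
  interpret ring D using D by (simp add: skew_field_def)
  interpret M: ring "mat_ring n D" by (rule ring_mat_ring)
  have one_index: "1 \<in> {1..n}" using n by simp
  show ?thesis
  proof
    show "mat_unit n D 1 1 \<one>\<^bsub>D\<^esub> \<otimes>\<^bsub>mat_ring n D\<^esub> mat_unit n D 1 1 \<one>\<^bsub>D\<^esub> = mat_unit n D 1 1 \<one>\<^bsub>D\<^esub>"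
      using one_index by (intro mat_eqI[of _ n D] mat_closed)
        (auto simp: mult_mat_unit_entry mat_unit_entry mat_unit_closed)
    show "mat_unit n D 1 1 \<one>\<^bsub>D\<^esub> \<noteq> \<zero>\<^bsub>mat_ring n D\<^esub>"
    proof
      assume "mat_unit n D 1 1 \<one>\<^bsub>D\<^esub> = \<zero>\<^bsub>mat_ring n D\<^esub>"
      from fun_cong[OF this, of "(1, 1)"] show False
        using D one_index by (simp add: mat_entry_simps skew_field_def)
    qed
  qed (use mat_ring_prime[OF D] mat_ring_corner_inverse[OF D n] in \<open>auto intro: mat_unit_closed\<close>)
qed

lemma rank_le_mat_ring:
  assumes D: "skew_field D" and n: "1 \<le> n" and M: "M \<in> carrier (mat_ring n D)"
  shows "prime_ring_minimal_idempotent.rank_le (mat_ring n D) (mat_unit n D 1 1 \<one>\<^bsub>D\<^esub>) n M"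
proof -
  interpret ring D using D by (simp add: skew_field_def)
  interpret M: prime_ring_minimal_idempotent "mat_ring n D" "mat_unit n D 1 1 \<one>\<^bsub>D\<^esub>"
    by (rule prime_ring_minimal_idempotent_mat_ring[OF D n])
  have one_index: "1 \<in> {1..n}" using n by simp
  let ?F = "(\<lambda>s. mat_unit n D 1 s \<one>\<^bsub>D\<^esub>) ` {1..n}"
  have "?F \<subseteq> M.rows"
  proof (clarify, rule M.rowsI)
    fix s assume s: "s \<in> {1..n}"
    show "mat_unit n D 1 1 \<one>\<^bsub>D\<^esub> \<otimes>\<^bsub>mat_ring n D\<^esub> mat_unit n D 1 s \<one>\<^bsub>D\<^esub> = mat_unit n D 1 s \<one>\<^bsub>D\<^esub>"
      using one_index by (intro mat_eqI[of _ n D] mat_closed)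
        (auto simp: mat_unit_mult_entry mat_unit_entry mat_unit_closed)
  qed (rule mat_unit_closed, simp)
  moreover have "M \<otimes>\<^bsub>mat_ring n D\<^esub> U = \<zero>\<^bsub>mat_ring n D\<^esub>"
    if U: "U \<in> carrier (mat_ring n D)"
      and zero: "\<forall>Q\<in>?F. Q \<otimes>\<^bsub>mat_ring n D\<^esub> U = \<zero>\<^bsub>mat_ring n D\<^esub>" for U
  proof -
    have "U (i, j) = \<zero>\<^bsub>D\<^esub>" if ij: "i \<in> {1..n}" "j \<in> {1..n}" for i j
    proof -
      have "U (i, j) = (mat_unit n D 1 i \<one>\<^bsub>D\<^esub> \<otimes>\<^bsub>mat_ring n D\<^esub> U) (1, j)"
        using one_index ij mat_entry_closed[OF U ij] by (simp add: mat_unit_mult_entry[OF U])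
      also have "\<dots> = \<zero>\<^bsub>D\<^esub>"
        using zero one_index ij by (simp add: mat_zero_entry)
      finally show ?thesis .
    qed
    then have "U = \<zero>\<^bsub>mat_ring n D\<^esub>"
      by (intro mat_eqI[of _ n D] U mat_zero_closed) (simp add: mat_zero_entry)
    then show ?thesis
      using M by simp
  qed
  moreover have "card ?F \<le> n"
    using card_image_le[of "{1..n}"] by force
  ultimately show ?thesis
    using M unfolding M.rank_le_def by (intro conjI exI[of _ ?F]) auto
qed

theorem idempotent_length_mat_ring_le:
  assumes D: "skew_field D" and n: "1 \<le> n" and A: "A \<in> carrier (sharp (mat_ring n D))"
  shows "idempotent_length (mat_ring n D) A \<le> enat n"
proof -
  interpret M: prime_ring_minimal_idempotent "mat_ring n D" "mat_unit n D 1 1 \<one>\<^bsub>D\<^esub>"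
    by (rule prime_ring_minimal_idempotent_mat_ring[OF D n])
  consider "A = \<one>\<^bsub>mat_ring n D\<^esub>" | "left_zero_divisor (mat_ring n D) A"
    using A by (auto simp: sharp_def)
  then show ?thesis
  proof cases
    case 1
    then show ?thesis
      by (simp add: M.idempotent_length_one)
  next
    case 2
    then have "A \<in> carrier (mat_ring n D)"
      by (simp add: left_zero_divisor_def)
    then show ?thesis
      using M.idempotent_length_le_rank[OF rank_le_mat_ring[OF D n] 2] by simp
  qed
qed

theorem idempotent_generated_mat_ring:
  assumes D: "skew_field D" and n: "1 \<le> n"
  shows "idempotent_generated (mat_ring n D) = carrier (sharp (mat_ring n D))"
proof
  interpret ring D using D by (simp add: skew_field_def)
  interpret M: ring "mat_ring n D" by (rule ring_mat_ring)
  show "idempotent_generated (mat_ring n D) \<subseteq> carrier (sharp (mat_ring n D))"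
    by (rule M.idempotent_generated_subset_sharp)
  show "carrier (sharp (mat_ring n D)) \<subseteq> idempotent_generated (mat_ring n D)"
    using idempotent_length_mat_ring_le[OF D n]
    by (auto simp: M.idempotent_generated_eq dest: enat_ile)
qed

theorem idempotent_generated_ring_iso_mat_rings:
  assumes R: "ring R" and I: "finite I"
    and D: "\<And>i. i \<in> I \<Longrightarrow> skew_field (D i)" and n: "\<And>i. i \<in> I \<Longrightarrow> 1 \<le> n i"
    and \<phi>: "\<phi> \<in> ring_iso R (product_ring I (\<lambda>i. mat_ring (n i) (D i)))"
  shows "\<phi> ` idempotent_generated R = (\<Pi>\<^sub>E i\<in>I. carrier (sharp (mat_ring (n i) (D i))))"
proof -
  have "monoid (mat_ring (n i) (D i))" if "i \<in> I" for i
    using D[OF that] by (simp add: skew_field_def ring.monoid_mat_ring)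
  then have "\<phi> ` idempotent_generated R = (\<Pi>\<^sub>E i\<in>I. idempotent_generated (mat_ring (n i) (D i)))"
    by (intro idempotent_generated_ring_iso_product[OF R I _ \<phi>])
  also have "\<dots> = (\<Pi>\<^sub>E i\<in>I. carrier (sharp (mat_ring (n i) (D i))))"
    by (intro PiE_cong idempotent_generated_mat_ring D n)
  finally show ?thesis .
qed

theorem mainTheorem7:
  fixes R :: "('r, 'm) ring_scheme"
    and D :: "nat \<Rightarrow> ('d, 'e) ring_scheme"
    and n :: "nat \<Rightarrow> nat" and k :: nat
    and \<phi> :: "'r \<Rightarrow> nat \<Rightarrow> nat \<times> nat \<Rightarrow> 'd"
  assumes "semisimple_ring R"
    and "1 \<le> k"
    and "\<forall>i\<in>{1..k}. skew_field (D i)"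
    and "\<forall>i\<in>{1..k}. 1 \<le> n i"
    and "\<forall>i\<in>{1..k}. \<forall>j\<in>{1..k}. i \<le> j \<longrightarrow> n i \<le> n j"
    and "\<phi> \<in> ring_iso R (product_ring {1..k} (\<lambda>i. mat_ring (n i) (D i)))"
  shows "\<phi> ` idempotent_generated R = (\<Pi>\<^sub>E i\<in>{1..k}. carrier (sharp (mat_ring (n i) (D i)))) \<and>
    (\<forall>x\<in>carrier R. \<phi> x \<in> (\<Pi>\<^sub>E i\<in>{1..k}. carrier (sharp (mat_ring (n i) (D i)))) \<longrightarrow>
      (\<forall>i\<in>{1..k}. idempotent_length (sharp (mat_ring (n i) (D i))) (\<phi> x i) \<noteq> \<infinity>) \<and>
      idempotent_length R x
        \<le> (MAX i\<in>{1..k}. idempotent_length (sharp (mat_ring (n i) (D i))) (\<phi> x i)) \<and>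
      idempotent_length R x \<le> enat (MAX i\<in>{1..k}. n i)) \<and>
    (MAX i\<in>{1..k}. n i) = n k"
proof -
  let ?M = "\<lambda>i. mat_ring (n i) (D i)"
  let ?X = "\<Pi>\<^sub>E i\<in>{1..k}. carrier (sharp (mat_ring (n i) (D i)))"
  note D = assms(3)[rule_format] and n = assms(4)[rule_format] and \<phi> = assms(6)
  have R: "ring R"
    using assms(1) by (simp add: semisimple_ring_def)
  have M: "ring (?M i)" if "i \<in> {1..k}" for i
    using D[OF that] by (simp add: skew_field_def ring.ring_mat_ring)
  have "\<phi> ` idempotent_generated R = ?X"
    by (rule idempotent_generated_ring_iso_mat_rings[OF R finite_atLeastAtMost D n \<phi>])
  moreover have length_le: "idempotent_length (?M i) (\<phi> x i) \<le> enat (n i)"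
    if "\<phi> x \<in> ?X" "i \<in> {1..k}" for x i
    by (rule idempotent_length_mat_ring_le[OF D[OF that(2)] n[OF that(2)] PiE_mem[OF that]])
  moreover have length_eq:
    "idempotent_length R x = (MAX i\<in>{1..k}. idempotent_length (?M i) (\<phi> x i))"
    if "x \<in> carrier R" for x
    using assms(2) ring.is_monoid[OF M]
    by (intro idempotent_length_ring_iso_product[OF R _ _ _ \<phi> that]) auto
  moreover have "idempotent_length R x \<le> enat (MAX i\<in>{1..k}. n i)"
    if "x \<in> carrier R" "\<phi> x \<in> ?X" for x
    unfolding length_eq[OF that(1)]
    using assms(2) by (auto intro!: Max.boundedI order_trans[OF length_le[OF that(2)]])
  moreover have "(MAX i\<in>{1..k}. n i) = n k"
    using assms(2,5) by (intro Max_eqI) auto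
  ultimately show ?thesis
    using enat_ile[OF length_le] by (auto simp: ring.idempotent_length_sharp[OF M])
qed

end
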